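(* Let $G$ be a finite simple claw-free graph with minimum degree $\delta(G)\geq 3$. Then $G$ has a cycle whose length is $2^{k}$ or $3\cdot 2^{k}$ for some positive integer $k$.
   Context: All graphs are finite and simple. A graph is claw-free if it does not contain $K_{1,3}$ as an induced subgraph. *)

theory Defs
  imports "Graph_Theory.Graph_Theory"
begin

text \<open>
  Finite simple graphs are rendered by the locale predicate \<^const>\<open>graph\<close>: finite, loop-free,
  symmetric digraphs without parallel arcs. An undirected edge is a pair of opposite arcs, so the
  degree of a vertex is its out-degree.
\<close>

text \<open>The value is meaningful only for finite graphs with at least one vertex.\<close>

definition min_degree :: "('a, 'b) pre_digraph \<Rightarrow> nat" where
  "min_degree G = Min (out_degree G ` verts G)"

definition claw_free :: "('a, 'b) pre_digraph \<Rightarrow> bool" where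
  "claw_free G \<longleftrightarrow> \<not> (\<exists>H. induced_subgraph H G \<and> complete_bipartite_digraph 1 3 H)"

text \<open>
  In a symmetric digraph an arc followed by its reverse is a \<^const>\<open>pre_digraph.cycle\<close> of
  length 2, but it is not a cycle of the undirected graph; the length bound excludes exactly
  these in a simple graph.
\<close>

definition undirected_cycle :: "('a, 'b) pre_digraph \<Rightarrow> 'b list \<Rightarrow> bool" where
  "undirected_cycle G p \<longleftrightarrow> pre_digraph.cycle G p \<and> 3 \<le> length p"

end

theory Submission
  imports Defs
begin

text \<open>
  Let \<open>C\<close> be a shortest cycle among those of length at least 4, and let \<open>n\<close> be its length; if
  \<open>n = 4\<close> we are done. For \<open>n \<ge> 5\<close> minimality makes \<open>C\<close> chordless, so at every vertex \<open>v\<close> of \<open>C\<close>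
  claw-freeness forces a third neighbour of \<open>v\<close>, which lies off \<open>C\<close>, to be adjacent to a
  neighbour of \<open>v\<close> on \<open>C\<close>. Thus of any two consecutive edges of \<open>C\<close> at least one
  is in a triangle whose apex is off \<open>C\<close>, and by minimality the apex has no further neighbour
  on \<open>C\<close>. Hence at least \<open>n div 2\<close> edges of \<open>C\<close> have pairwise distinct apices, and detouring
  through an arbitrary selection of them gives cycles of all lengths from \<open>n\<close> to \<open>n + n div 2\<close>.
  One of these lengths has the form \<open>2 ^ k\<close> or \<open>3 * 2 ^ k\<close>, as
  consecutive numbers of this form have ratio at most \<open>3 / 2\<close>.
\<close>

section \<open>Closed paths as vertex lists\<close>

definition closed_path :: "('a \<Rightarrow> 'a \<Rightarrow> bool) \<Rightarrow> 'a list \<Rightarrow> bool" where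
  "closed_path E xs \<longleftrightarrow>
    distinct xs \<and> 3 \<le> length xs \<and> successively E xs \<and> E (last xs) (hd xs)"

text \<open>Minimality is among lengths at least 4, so triangles do not compete; the bound 5 records
  that 4-cycles are absent.\<close>

definition shortest_closed_path :: "('a \<Rightarrow> 'a \<Rightarrow> bool) \<Rightarrow> 'a list \<Rightarrow> bool" where
  "shortest_closed_path E xs \<longleftrightarrow> closed_path E xs \<and> 5 \<le> length xs \<and>
    (\<forall>ys. closed_path E ys \<and> 4 \<le> length ys \<longrightarrow> length xs \<le> length ys)"

lemmas closed_path_simps =
  closed_path_def successively_append_iff successively_Cons hd_append

lemma shortest_closed_pathD:
  "shortest_closed_path E xs \<Longrightarrow> closed_path E ys \<Longrightarrow> 4 \<le> length ys \<Longrightarrow> length xs \<le> length ys"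
  by (auto simp: shortest_closed_path_def)

lemma closed_path_rotate1: "closed_path E xs \<Longrightarrow> closed_path E (rotate1 xs)"
  by (cases xs) (auto simp: closed_path_simps split: if_splits)

lemma shortest_closed_path_rotate:
  assumes "shortest_closed_path E xs"
  shows "shortest_closed_path E (rotate m xs)"
proof -
  have "closed_path E (rotate m xs)"
  proof (induction m)
    case 0
    show ?case using assms by (simp add: shortest_closed_path_def)
  next
    case (Suc m)
    then show ?case using closed_path_rotate1 by (simp add: rotate_def)
  qed
  then show ?thesis using assms by (simp add: shortest_closed_path_def)
qed

lemma rotate_conv_nth:
  assumes "m < length xs"
  shows "rotate m xs = map (\<lambda>i. xs ! ((m + i) mod length xs)) [0..<length xs]"
  using assms by (auto intro!: nth_equalityI simp: nth_rotate)

section \<open>Gaps between numbers of the two forms\<close>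

lemma ex_pow2_or_3pow2_between:
  fixes n :: nat
  assumes "5 \<le> n"
  shows "\<exists>N k. n \<le> N \<and> N \<le> n + n div 2 \<and> k > 0 \<and> (N = 2 ^ k \<or> N = 3 * 2 ^ k)"
proof -
  have "1 \<le> n - 1" using assms by simp
  \<comment> \<open>Bracketing \<open>n - 1\<close> instead of \<open>n\<close> gives
    \<open>4 * q < n \<le> 8 * q\<close> below, so the next number of the required form is
    \<open>6 * q\<close> or \<open>8 * q\<close>.\<close>
  from ex_power_ivl1[OF order_refl this] obtain k where
    k: "2 ^ k \<le> n - 1" "n - 1 < 2 ^ (k + 1)"
    by blast
  have "2 \<le> k"
  proof (rule ccontr)
    assume "\<not> 2 \<le> k"
    then have "(2::nat) ^ (k + 1) \<le> 2 ^ 2" by (intro power_increasing) auto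
    then show False using k assms by simp
  qed
  then obtain j where j: "k = j + 2" by (metis add.commute le_Suc_ex)
  define q where "q = (2::nat) ^ j"
  have "(2::nat) ^ k = 4 * q" "(2::nat) ^ (k + 1) = 8 * q"
    by (simp_all add: j q_def power_add)
  then have q: "4 * q < n" "n \<le> 8 * q" using k assms by linarith+
  show ?thesis
  proof (cases "n \<le> 6 * q")
    case True
    have "3 * 2 ^ (j + 1) = 6 * q" by (simp add: q_def)
    moreover have "6 * q \<le> n + n div 2" using q by linarith
    ultimately show ?thesis using True by (metis add_gr_0 zero_less_one)
  next
    case False
    have "2 ^ (j + 3) = 8 * q" by (simp add: q_def power_add)
    moreover have "8 * q \<le> n + n div 2" using False by linarith
    ultimately show ?thesis using q by (metis add_gr_0 zero_less_numeral)
  qed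
qed

text \<open>The combinatorial argument concerns adjacency alone, so it is carried out for a
  relation; arcs return only in the final translation.\<close>

locale claw_free_adjacency =
  fixes E :: "'a \<Rightarrow> 'a \<Rightarrow> bool" and V :: "'a set"
  assumes finite_V: "finite V"
    and E_in_V: "E x y \<Longrightarrow> x \<in> V"
    and E_sym: "E x y \<Longrightarrow> E y x"
    and E_irrefl: "\<not> E x x"
    and deg: "x \<in> V \<Longrightarrow> 3 \<le> card {y. E x y}"
    and no_claw: "\<lbrakk>E v a; E v b; E v c; distinct [a, b, c]\<rbrakk> \<Longrightarrow> E a b \<or> E a c \<or> E b c"
begin

section \<open>Existence of a closed path of length at least 4\<close>

lemma ex_neighbour_avoiding:
  assumes "x \<in> V" "finite S" "card S \<le> 2"
  shows "\<exists>y. E x y \<and> y \<notin> S"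
proof (rule ccontr)
  assume "\<not> ?thesis"
  then have "{y. E x y} \<subseteq> S" by blast
  then have "card {y. E x y} \<le> card S" using assms(2) by (rule card_mono[rotated])
  then show False using deg[OF assms(1)] assms(3) by linarith
qed

text \<open>The closed path is cut out of a longest path by an edge at its first vertex.\<close>

lemma ex_closed_path_ge_4:
  assumes "V \<noteq> {}"
  shows "\<exists>xs. closed_path E xs \<and> 4 \<le> length xs"
proof -
  define P where "P xs \<longleftrightarrow> distinct xs \<and> set xs \<subseteq> V \<and> successively E xs" for xs
  obtain v where "v \<in> V" using assms by blast
  then have Pv: "P [v]" by (simp add: P_def)
  have "\<forall>xs. P xs \<longrightarrow> length xs < Suc (card V)"
    unfolding P_def by (metis card_mono distinct_card finite_V le_imp_less_Suc)
  then obtain xs where xs: "P xs" and max: "\<And>ys. P ys \<Longrightarrow> length ys \<le> length xs"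
    using ex_has_greatest_nat[of P "[v]" length] Pv by (metis less_imp_le)
  have "xs \<noteq> []" using max[OF Pv] by auto
  then obtain u ys where uys: "xs = u # ys" by (cases xs) auto
  have uV: "u \<in> V" using xs by (simp add: P_def uys)
  \<comment> \<open>A neighbour of \<open>u\<close> off the path would extend the longest path at
    its head.\<close>
  have nb: "y \<in> set ys" if "E u y" for y
  proof (rule ccontr)
    assume "y \<notin> set ys"
    moreover have "y \<noteq> u" using that E_irrefl by blast
    ultimately have "P (y # xs)"
      using xs E_sym[OF that] E_in_V by (auto simp: P_def uys)
    then show False using max by fastforce
  qed
  have "card (set (take 2 ys)) \<le> 2"
    by (rule order_trans[OF card_length]) simp
  \<comment> \<open>Avoiding the first two vertices after \<open>u\<close> puts \<open>z\<close> at
    least three steps away, so the edge back to \<open>u\<close> closes at least 4 vertices.\<close>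
  then obtain z where z: "E u z" "z \<notin> set (take 2 ys)"
    using ex_neighbour_avoiding[OF uV, of "set (take 2 ys)"] by auto
  have "z \<in> set (drop 2 ys)"
    using nb[OF z(1)] z(2) by (metis Un_iff append_take_drop_id set_append)
  moreover from this have "2 \<le> length ys" by (cases "2 \<le> length ys") auto
  ultimately obtain a b cs where ys: "ys = a # b # cs" "z \<in> set cs"
    by (cases ys rule: remdups_adj.cases) (auto simp: numeral_2_eq_2)
  then obtain as bs where "cs = as @ z # bs" by (meson split_list)
  then have "closed_path E (u # a # b # as @ [z])"
    using xs E_sym[OF z(1)]
    by (auto simp: P_def uys ys closed_path_simps)
  then show ?thesis by fastforce
qed

section \<open>Chords and apices of a shortest cycle\<close>

lemma shortest_closed_path_chordless:
  assumes sh: "shortest_closed_path E (x # y # ys)" and "z \<in> set ys" "z \<noteq> last ys"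
  shows "\<not> E x z"
proof
  assume xz: "E x z"
  obtain as bs where ys: "ys = as @ z # bs" using assms(2) by (meson split_list)
  then have bs: "bs \<noteq> []" using assms(3) by auto
  have cp: "closed_path E (x # y # as @ z # bs)" and len: "5 \<le> length (x # y # as @ z # bs)"
    using sh by (auto simp: shortest_closed_path_def ys)
  \<comment> \<open>The chord splits the cycle in two. The first piece is too short, unless
    \<open>as\<close> is empty and it is a triangle; then the second piece is just one shorter than
    the cycle and still has length at least 4.\<close>
  have "closed_path E (x # y # as @ [z])"
    using cp E_sym[OF xz] by (auto simp: closed_path_simps)
  moreover have "closed_path E (x # z # bs)"
    using cp xz bs len
    by (cases bs) (auto simp: closed_path_simps)
  ultimately show False
    using shortest_closed_pathD[OF sh] bs len unfolding ys
    by (cases as) fastforce+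
qed

text \<open>A third neighbour \<open>z\<close> of \<open>x\<close> yields a 4-cycle if it is next to
  \<open>a\<close> or \<open>b\<close> on the cycle. Otherwise the path from \<open>b\<close> to
  \<open>z\<close>, closed through \<open>x\<close>, is a shortcut of length at least 4. This is
  what later makes apices of different edges distinct.\<close>

lemma shortest_closed_path_apex:
  assumes sh: "shortest_closed_path E (a # b # ys)" and x: "x \<notin> set (a # b # ys)"
    and xa: "E x a" and xb: "E x b" and "z \<in> set ys"
  shows "\<not> E x z"
proof
  assume xz: "E x z"
  obtain as bs where ys: "ys = as @ z # bs" using assms(5) by (meson split_list)
  have cp: "closed_path E (a # b # as @ z # bs)" and len: "5 \<le> length (a # b # as @ z # bs)"
    using sh by (auto simp: shortest_closed_path_def ys)
  have c1: "closed_path E (x # b # as @ [z])"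
    using cp xb E_sym[OF xz] x ys
    by (auto simp: closed_path_simps)
  have c2: "closed_path E [x, a, b, z]" if "as = []"
    using cp xa E_sym[OF xz] x ys that by (auto simp: closed_path_def)
  have c3: "closed_path E [x, z, a, b]" if "bs = []"
    using cp xz E_sym[OF xb] x ys that
    by (auto simp: closed_path_simps)
  show False
  proof (cases "as = [] \<or> bs = []")
    case True
    then show False
      using shortest_closed_pathD[OF sh c2] shortest_closed_pathD[OF sh c3] len
      unfolding ys by auto
  next
    case False
    then show False
      using shortest_closed_pathD[OF sh c1] unfolding ys by (cases as; cases bs) auto
  qed
qed

lemma shortest_closed_path_triangle:
  assumes sh: "shortest_closed_path E (u # v # w # ys)"
  shows "\<exists>x. x \<notin> set (u # v # w # ys) \<and> E x v \<and> (E x u \<or> E x w)"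
proof -
  have cp: "closed_path E (u # v # w # ys)" and len: "2 \<le> length ys"
    using sh by (auto simp: shortest_closed_path_def)
  then have vu: "E v u" and vw: "E v w" and dist: "distinct (u # v # w # ys)"
    using E_sym by (auto simp: closed_path_def)
  obtain x where x: "E v x" "x \<notin> {u, w}"
    using ex_neighbour_avoiding[of v "{u, w}"] E_in_V[OF vu] dist by auto
  \<comment> \<open>With \<open>v\<close> in front, the vertices other than its two neighbours on
    the cycle are exactly \<open>ys\<close>, so chordlessness keeps \<open>x\<close> off
    \<open>ys\<close>.\<close>
  have sh': "shortest_closed_path E (v # w # ys @ [u])"
    using shortest_closed_path_rotate[OF sh, of 1] by simp
  have "x \<notin> set ys"
    using shortest_closed_path_chordless[OF sh', of x] x by auto
  then have out: "x \<notin> set (u # v # w # ys)"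
    using x E_irrefl by auto
  have "\<not> E u w"
    using shortest_closed_path_chordless[OF sh, of w] dist len
    by (metis last_ConsR last_in_set list.set_intros(1) distinct.simps(2) length_0_conv
        not_numeral_le_zero)
  then have "E u x \<or> E w x"
    using no_claw[OF vu vw x(1)] x(2) dist by auto
  then show ?thesis using out x(1) E_sym by blast
qed

section \<open>Lengthening a cycle by detours\<close>

lemma detour:
  assumes cp: "closed_path E xs" and J: "J \<subseteq> {..<length xs}"
    and inj: "inj_on t J" and out: "\<And>i. i \<in> J \<Longrightarrow> t i \<notin> set xs"
    and apex: "\<And>i. i \<in> J \<Longrightarrow> E (t i) (xs ! i) \<and> E (t i) (xs ! (Suc i mod length xs))"
  shows "\<exists>ys. closed_path E ys \<and> length ys = length xs + card J"
proof -
  define n where "n = length xs"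
  have n: "3 \<le> n" and dist: "distinct xs" using cp by (auto simp: closed_path_def n_def)
  have edge: "E (xs ! i) (xs ! (Suc i mod n))" if "i < n" for i
  proof (cases "Suc i < n")
    case True
    then show ?thesis using cp by (auto simp: closed_path_def n_def successively_conv_nth)
  next
    case False
    with that have "Suc i = n" by simp
    moreover from this have "last xs = xs ! i" "hd xs = xs ! 0"
      by (auto simp: n_def last_conv_nth hd_conv_nth simp flip: \<open>Suc i = n\<close>)
        (metis diff_Suc_1 last_conv_nth length_0_conv n_def nat.distinct(1),
         metis hd_conv_nth length_0_conv n_def nat.distinct(1))
    ultimately show ?thesis using cp by (simp add: closed_path_def)
  qed
  \<comment> \<open>The block \<open>f i\<close> inserts the apex \<open>t i\<close> between vertex
    \<open>i\<close> and its successor.\<close>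
  define f where "f i = (if i \<in> J then [xs ! i, t i] else [xs ! i])" for i
  define z where "z m = concat (map f [0..<m])" for m
  have z_Suc: "z (Suc m) = z m @ f m" for m by (simp add: z_def)
  have set_z: "set (z m) = (!) xs ` {..<m} \<union> t ` (J \<inter> {..<m})" for m
    by (induction m) (auto simp: z_Suc f_def lessThan_Suc, auto simp: z_def)
  have len_z: "length (z m) = m + card (J \<inter> {..<m})" for m
    by (induction m) (auto simp: z_Suc f_def lessThan_Suc, auto simp: z_def)
  \<comment> \<open>The last conjunct links the list to the next block; at \<open>m = n\<close> the
    \<open>mod\<close> turns it into the closing edge.\<close>
  have path: "distinct (z m) \<and> successively E (z m) \<and>
      (0 < m \<longrightarrow> z m \<noteq> [] \<and> hd (z m) = xs ! 0 \<and> E (last (z m)) (xs ! (m mod n)))" if "m \<le> n" for m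
    using that
  proof (induction m)
    case 0
    show ?case by (simp add: z_def)
  next
    case (Suc m)
    then have m: "m < n" by simp
    have xm: "xs ! m \<in> set xs" using m by (simp add: n_def)
    have "\<forall>i\<in>J. t i \<noteq> xs ! m" using out xm by metis
    then have "xs ! m \<notin> set (z m)"
      using dist m by (auto simp: set_z n_def nth_eq_iff_index_eq)
    moreover have "t m \<notin> set (z m)" if "m \<in> J"
      using out[OF that] m inj that by (auto simp: set_z n_def dest: inj_onD)
    ultimately have "distinct (z m @ f m)"
      using Suc.IH m \<open>\<forall>i\<in>J. t i \<noteq> xs ! m\<close> by (auto simp: f_def)
    moreover have f: "f m \<noteq> []" "hd (f m) = xs ! m" by (simp_all add: f_def)
    moreover have "successively E (f m)" "E (last (f m)) (xs ! (Suc m mod n))"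
      using edge[OF m] apex[of m] E_sym[of "t m" "xs ! m"] by (auto simp: f_def n_def)
    moreover have "z m \<noteq> [] \<and> hd (z m) = xs ! 0 \<and> E (last (z m)) (xs ! m)" if "m \<noteq> 0"
      using Suc.IH m that by simp
    moreover have "z 0 = []" by (simp add: z_def)
    moreover have "successively E (z m)" using Suc.IH m by simp
    ultimately show ?case
      by (cases "m = 0") (simp_all add: z_Suc successively_append_iff)
  qed
  have "J \<inter> {..<n} = J" using J by (auto simp: n_def)
  then have len: "length (z n) = n + card J" using len_z[of n] by simp
  then have "closed_path E (z n)" using path[of n] n by (simp add: closed_path_def)
  then show ?thesis using len n_def by blast
qed

text \<open>Detours are taken at \<open>N - n\<close> edges out of the set \<open>T\<close> of edges
  with an apex. Enough of them exist by pairing up consecutive edges, and their apices differ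
  because each sees only the ends of its own edge.\<close>

lemma closed_path_lengths:
  assumes sh: "shortest_closed_path E xs"
    and N: "length xs \<le> N" "N \<le> length xs + length xs div 2"
  shows "\<exists>ys. closed_path E ys \<and> length ys = N"
proof -
  define n where "n = length xs"
  have n: "5 \<le> n" and cp: "closed_path E xs" and dist: "distinct xs"
    using sh by (auto simp: shortest_closed_path_def closed_path_def n_def)
  define apex where "apex i x \<longleftrightarrow> x \<notin> set xs \<and> E x (xs ! i) \<and> E x (xs ! (Suc i mod n))" for i x
  define T where "T = {i. i < n \<and> (\<exists>x. apex i x)}"
  define t where "t i = (SOME x. apex i x)" for i
  have t: "apex i (t i)" if "i \<in> T" for i
    using that unfolding T_def t_def by (auto intro: someI)
  have rot: "rotate i xs =
      xs ! i # xs ! (Suc i mod n) # xs ! ((i + 2) mod n) # map (\<lambda>k. xs ! ((i + k) mod n)) [3..<n]"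
    if "i < n" for i
  proof -
    have "[0..<n] = [0..<3] @ [3..<n]"
      using n upt_add_eq_append[of 0 3 "n - 3"] by simp
    moreover have "[0..<3] = [0, 1, 2::nat]" by (simp add: upt_rec)
    ultimately have "[0..<n] = 0 # 1 # 2 # [3..<n]" by simp
    then show ?thesis
      using rotate_conv_nth[of i xs] that by (simp add: n_def)
  qed
  \<comment> \<open>Edges \<open>2 * j\<close> and \<open>Suc (2 * j)\<close> share the vertex
    \<open>Suc (2 * j)\<close>, where the triangle lemma applies. For odd \<open>n\<close> one edge
    stays unpaired.\<close>
  have pair: "2 * j \<in> T \<or> Suc (2 * j) \<in> T" if "j < n div 2" for j
  proof -
    have j: "2 * j < n" "Suc (2 * j) < n" using that by auto
    obtain ys where
      eq: "rotate (2 * j) xs = xs ! (2 * j) # xs ! Suc (2 * j) # xs ! ((2 * j + 2) mod n) # ys"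
      using rot[OF j(1)] j(2) by simp
    obtain x where "x \<notin> set (rotate (2 * j) xs)" "E x (xs ! Suc (2 * j))"
      "E x (xs ! (2 * j)) \<or> E x (xs ! ((2 * j + 2) mod n))"
      using shortest_closed_path_triangle[OF shortest_closed_path_rotate[OF sh, of "2 * j", unfolded eq]]
      unfolding eq by blast
    then have "apex (2 * j) x \<or> apex (Suc (2 * j)) x" using j by (auto simp: apex_def)
    then show ?thesis using j by (auto simp: T_def)
  qed
  \<comment> \<open>Halving the index sends an edge to its pair; every pair is hit.\<close>
  have "{..<n div 2} \<subseteq> (\<lambda>i. i div 2) ` T"
  proof
    fix j assume "j \<in> {..<n div 2}"
    then show "j \<in> (\<lambda>i. i div 2) ` T"
      using pair[of j] by (force intro: image_eqI[of _ _ "2 * j"] image_eqI[of _ _ "Suc (2 * j)"])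
  qed
  moreover have fin: "finite T" by (simp add: T_def)
  ultimately have "n div 2 \<le> card T"
    using surj_card_le by fastforce
  then have "N - n \<le> card T" using N by (simp add: n_def)
  then obtain J where J: "J \<subseteq> T" "card J = N - n"
    using obtain_subset_with_card_n by metis
  have inj: "inj_on t T"
  proof (rule inj_onI)
    fix i j assume i: "i \<in> T" and j: "j \<in> T" and eq: "t i = t j"
    have lt: "i < n" "j < n" using i j by (auto simp: T_def)
    have "shortest_closed_path E (rotate i xs)"
      by (rule shortest_closed_path_rotate[OF sh])
    moreover obtain ys where ys: "rotate i xs = xs ! i # xs ! (Suc i mod n) # ys"
      using rot[OF lt(1)] by blast
    ultimately have no: "\<not> E (t i) y" if "y \<in> set ys" for y
      using shortest_closed_path_apex[of _ _ ys "t i" y] t[OF i] that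
      by (metis apex_def set_rotate)
    have only: "k \<in> {i, Suc i mod n}" if "k < n" "E (t i) (xs ! k)" for k
    proof -
      have "xs ! k \<in> set (rotate i xs)" using that by (simp add: n_def)
      then have "xs ! k = xs ! i \<or> xs ! k = xs ! (Suc i mod n)"
        using no[OF _] that by (auto simp: ys)
      moreover have "Suc i mod n < n" using n by simp
      ultimately show ?thesis
        using dist that lt by (auto simp: n_def nth_eq_iff_index_eq)
    qed
    have "Suc j mod n < n" using n by simp
    then have "j \<in> {i, Suc i mod n}" "Suc j mod n \<in> {i, Suc i mod n}"
      using only t[OF j] lt by (auto simp: eq apex_def)
    \<comment> \<open>If \<open>i\<close> and \<open>j\<close> differed, each would be the cyclic
      successor of the other, which forces \<open>n\<close> to divide 2.\<close>
    then show "i = j" using lt n by (auto simp: mod_Suc split: if_splits)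
  qed
  have "\<exists>ys. closed_path E ys \<and> length ys = length xs + card J"
  proof (rule detour[OF cp])
    show "J \<subseteq> {..<length xs}" using J by (auto simp: T_def n_def)
    show "inj_on t J" using inj J(1) by (rule inj_on_subset)
  qed (use t J in \<open>auto simp: apex_def n_def\<close>)
  then show ?thesis using J N by (simp add: n_def)
qed

lemma ex_closed_path_pow2_or_3pow2:
  assumes "V \<noteq> {}"
  shows "\<exists>xs k. closed_path E xs \<and> k > 0 \<and> (length xs = 2 ^ k \<or> length xs = 3 * 2 ^ k)"
proof -
  obtain xs where xs: "closed_path E xs" "4 \<le> length xs"
    and min: "\<And>ys. closed_path E ys \<and> 4 \<le> length ys \<Longrightarrow> length xs \<le> length ys"
    using ex_has_least_nat[of "\<lambda>xs. closed_path E xs \<and> 4 \<le> length xs" _ length]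
      ex_closed_path_ge_4[OF assms] by blast
  show ?thesis
  proof (cases "length xs = 4")
    case True
    then have "length xs = 2 ^ 2" by simp
    then show ?thesis using xs(1) by (metis zero_less_numeral)
  next
    case False
    then have "shortest_closed_path E xs" using xs min by (simp add: shortest_closed_path_def)
    moreover obtain N k where "length xs \<le> N" "N \<le> length xs + length xs div 2" "k > 0"
      "N = 2 ^ k \<or> N = 3 * 2 ^ k"
      using ex_pow2_or_3pow2_between[of "length xs"] xs False by auto
    ultimately show ?thesis using closed_path_lengths by metis
  qed
qed

end

section \<open>Translation to digraphs\<close>

lemma (in wf_digraph) ex_awalk_of_successively:
  assumes "successively (dominates G) (u # ys)" "u \<in> verts G"
  shows "\<exists>p. awalk u p (last (u # ys)) \<and> awalk_verts u p = u # ys"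
  using assms
proof (induction ys arbitrary: u)
  case Nil
  then show ?case by (intro exI[of _ "[]"]) (simp add: awalk_def)
next
  case (Cons y ys)
  then obtain e where e: "e \<in> arcs G" "tail G e = u" "head G e = y" by auto
  with Cons obtain p where "awalk y p (last (y # ys))" "awalk_verts y p = y # ys"
    by (metis head_in_verts successively.simps(3))
  with e Cons.prems show ?case by (intro exI[of _ "e # p"]) (simp add: awalk_Cons_iff)
qed

text \<open>Repeating \<open>u\<close> at the end makes the closing edge an arc of the walk.
  \<open>cycle\<close> asks for distinctness only of the tail \<open>ys @ [u]\<close>, a rotation of
  \<open>xs\<close>.\<close>

lemma (in wf_digraph) ex_undirected_cycle_of_closed_path:
  assumes "closed_path (dominates G) xs"
  shows "\<exists>p. undirected_cycle G p \<and> length p = length xs"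
proof -
  obtain u ys where xs: "xs = u # ys" "ys \<noteq> []"
    using assms by (cases xs rule: remdups_adj.cases) (auto simp: closed_path_def)
  have "successively (dominates G) (u # ys @ [u])"
    using assms xs by (auto simp: closed_path_simps)
  moreover have "u \<in> verts G"
    using assms by (auto simp: xs closed_path_def dest: adj_in_verts)
  ultimately obtain p where p: "awalk u p u" "awalk_verts u p = u # ys @ [u]"
    using ex_awalk_of_successively[of u "ys @ [u]"] by auto
  have "length p = length xs"
    using arg_cong[OF p(2), of length] by (simp add: length_awalk_verts xs)
  moreover from this have "cycle p"
    using p assms by (auto simp: cycle_def closed_path_def xs)
  ultimately show ?thesis using assms by (auto simp: undirected_cycle_def closed_path_def)
qed

text \<open>In the absence of parallel arcs, \<open>head G\<close> is injective on the arcs leaving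
  \<open>v\<close>.\<close>

lemma (in graph) out_degree_eq_card_neighbours: "out_degree G v = card {w. dominates G v w}"
proof -
  have "{w. dominates G v w} = head G ` out_arcs G v"
    by (auto simp: arcs_ends_conv)
  moreover have "inj_on (head G) (out_arcs G v)"
    using no_multi_arcs by (auto intro!: inj_onI simp: arc_to_ends_def)
  ultimately show ?thesis by (simp add: out_degree_def card_image)
qed

text \<open>Three pairwise non-adjacent neighbours of \<open>v\<close> would induce, together with
  \<open>v\<close>, the complete bipartite digraph with parts \<open>{v}\<close> and
  \<open>{a, b, c}\<close>.\<close>

lemma (in graph) claw_freeD:
  assumes "claw_free G" "dominates G v a" "dominates G v b" "dominates G v c" "distinct [a, b, c]"
  shows "dominates G a b \<or> dominates G a c \<or> dominates G b c"
proof (rule ccontr)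
  assume indep: "\<not> ?thesis"
  define H where "H = G \<restriction> {v, a, b, c}"
  have sub: "{v, a, b, c} \<subseteq> verts G" using assms adj_in_verts by blast
  have ind: "induced_subgraph H G"
    unfolding H_def using sub by (rule induced_induce)
  have neq: "v \<notin> {a, b, c}" using assms adj_not_same by blast
  have ends: "arcs_ends H = {v} \<times> {a, b, c} \<union> {a, b, c} \<times> {v}"
  proof -
    have "arcs_ends H = {(x, y). dominates G x y \<and> x \<in> {v, a, b, c} \<and> y \<in> {v, a, b, c}}"
      unfolding H_def by (auto simp: arcs_ends_conv induce_subgraph_def)
    moreover have "dominates G a v" "dominates G b v" "dominates G c v"
      using assms(2-4) graph_symmetric by blast+
    moreover have "\<not> dominates G b a" "\<not> dominates G c a" "\<not> dominates G c b"
      using indep graph_symmetric by blast+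
    moreover have "\<not> dominates G x x" for x using adj_not_same by blast
    ultimately show ?thesis using assms(2-4) indep by auto
  qed
  have "graph H"
    using digraph.graphI[OF digraphI_induced[OF ind]]
      induced_graph_imp_symmetric[OF sym_arcs ind] .
  have "card {v} = 1" "card {a, b, c} = 3" using assms(5) by simp_all
  moreover have "verts H = {v} \<union> {a, b, c}" by (auto simp: H_def)
  moreover have "{v} \<inter> {a, b, c} = {}" using neq by blast
  ultimately have "complete_bipartite_digraph 1 3 H"
    unfolding complete_bipartite_digraph_def using \<open>graph H\<close> ends by metis
  then show False using assms(1) ind by (auto simp: claw_free_def)
qed

theorem theorem1:
  fixes G :: "('a, 'b) pre_digraph"
  assumes "graph G"
    and "verts G \<noteq> {}"
    and "claw_free G"
    and "min_degree G \<ge> 3"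
  shows "\<exists>p k. undirected_cycle G p \<and> k > 0 \<and> (length p = 2 ^ k \<or> length p = 3 * 2 ^ k)"
proof -
  interpret graph G by fact
  interpret claw_free_adjacency "dominates G" "verts G"
  proof
    fix v assume v: "v \<in> verts G"
    then have "min_degree G \<le> out_degree G v" by (simp add: min_degree_def)
    then show "3 \<le> card {w. dominates G v w}"
      using assms(4) by (simp add: out_degree_eq_card_neighbours)
  qed (use claw_freeD[OF assms(3)] adj_not_same graph_symmetric in \<open>auto dest: adj_in_verts\<close>)
  obtain xs k where "closed_path (dominates G) xs" "k > 0"
    "length xs = 2 ^ k \<or> length xs = 3 * 2 ^ k"
    using ex_closed_path_pow2_or_3pow2[OF assms(2)] by blast
  then show ?thesis using ex_undirected_cycle_of_closed_path by metis
qed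

end
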